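(* Let $M$ be a finitely generated conically pre-ordered commutative monoid, and let $\phi$ be an $M$-filter functor (on finitely generated nilpotent groups) such that for every group $G$ the $(M,G)$-filter $\phi(G)$ is finite, inertia-free and faithful. Then for all (finitely generated nilpotent) groups $G$ and $H$, every isomorphism $G\to H$ is a lift of some $M$-graded Lie ring isomorphism $L(\phi(G))\to L(\phi(H))$.
   Context: Conventions. All groups $G$ are finitely generated nilpotent; $[x,y]=x^{-1}y^{-1}xy$, and for subgroups $[X,Y]=\langle [x,y]: x\in X,y\in Y\rangle$. $M$ is a finitely generated commutative monoid (written additively). A conically pre-ordered monoid is a commutative monoid $M$ with a pre-order $\preceq$ such that $s\preceq t$, $s'\preceq t'$ imply $s+s'\preceq t+t'$, and with minimal element $0$ (that is, $0\preceq s$ for all $s$, and $s\preceq 0$ only if $s=0$). Filters. An $(M,G)$-filter is a function $\phi$ from $M$ to the set of normal subgroups of $G$, $s\mapsto\phi_s$, with $\langle \phi_s: s\neq 0\rangle=G$, $\bigcap_{s\in M}\phi_s=1$, and for all $s,t\in M$: $[\phi_s,\phi_t]\le\phi_{s+t}$, and $s\preceq t\Rightarrow \phi_s\ge\phi_t$. It is finite if $\operatorname{im}(\phi)$ is a finite set. The boundary is $\partial\phi_s=\langle\phi_{s+t}: t\ne 0\rangle$. The $M$-graded Lie ring is $L(\phi)=\bigoplus_{s\ne0}L_s(\phi)$, $L_s(\phi)=\phi_s/\partial\phi_s$, with bracket $[x\partial\phi_s,y\partial\phi_t]=[x,y]\partial\phi_{s+t}$; a graded isomorphism maps each component of degree $s$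 onto the component of degree $s$. Inertia-free. Let $\mathfrak B_0=\{\langle1\rangle\}$ and $\mathfrak B_{i+1}=\{\phi_s : \exists B\subseteq\mathfrak B_i,\ \partial\phi_s=\langle B\rangle\}$, $\mathfrak B=\bigcup_{i\ge0}\mathfrak B_i$. The filter $\phi$ is inertia-free if $\mathfrak B=\operatorname{im}(\phi)$. Faithful. $\operatorname{Lat}(\phi)$ is the closure of $\operatorname{im}(\phi)$ under intersections and products of subgroups. $\phi$ is faithful if there is $\mathcal X\subseteq G$ such that (i) $\langle H\cap\mathcal X\rangle=H$ for all $H\in\operatorname{Lat}(\phi)$; (ii) $H\mapsto H\cap\mathcal X$ is a lattice embedding of $\operatorname{Lat}(\phi)$ into the lattice of subsets of $\mathcal X$ (with $\cap,\cup$); (iii) for each $x\in\mathcal X$ there is a unique $s\in M$ with $x\in\phi_s\setminus\partial\phi_s$. Filter functors. An $M$-filter functor $\phi$ assigns to each group $G$ an $(M,G)$-filter $\phi(G)$ (with subgroups $\phi_s(G)$), functorially: the category of $M$-filtered groups has as morphisms the group homomorphisms $\alpha:G\to H$ with $(\phi_s(G))^\alpha\le\phi_s(H)$ for all $s\in M$, and every group homomorphism is such a morphism for the assigned filters. Lifts. Let $\phi$ be an $(M,G)$-filter, $\theta$ an $(M,H)$-filter, $\beta:L(\phi)\to L(\theta)$ an $M$-graded isomorphism, and $\mathcal I_\phi=\{s\in M: \partial\phi_s\ne\phi_s\text{ or }\phi_s=1\}$. For each $s$ choose transversals (set-theoretic sections) $\tau_s:\phi_s/\partial\phi_s\to\phi_s$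 and $\sigma_s:\theta_s/\partial\theta_s\to\theta_s$, and let $\mathcal X_s$ be the image under $\tau_s$ of a generating set of $L_s(\phi)$. The corresponding partial lift of $\beta$ is the function $\bigsqcup_{s\in\mathcal I_\phi}\mathcal X_s\to H$ sending $x\in\mathcal X_s$ to $(\partial\phi_s x)^{\beta\sigma_s}$. A homomorphism $G\to H$ is a lift of $\beta$ if, for some such choices, it is induced by the partial lift, i.e. $\bigcup_{s\in\mathcal I_\phi}\mathcal X_s$ generates $G$ and the homomorphism agrees with the partial lift on every $\mathcal X_s$. *)

theory Defs
  imports "HOL-Algebra.Product_Groups" "HOL-Algebra.FiniteProduct"
begin

subsection \<open>Finitely generated nilpotent groups\<close>

definition commutator :: "('g, 'x) monoid_scheme \<Rightarrow> 'g \<Rightarrow> 'g \<Rightarrow> 'g" where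
  "commutator G x y = inv\<^bsub>G\<^esub> x \<otimes>\<^bsub>G\<^esub> inv\<^bsub>G\<^esub> y \<otimes>\<^bsub>G\<^esub> x \<otimes>\<^bsub>G\<^esub> y"

definition commutator_subgroup :: "('g, 'x) monoid_scheme \<Rightarrow> 'g set \<Rightarrow> 'g set \<Rightarrow> 'g set" where
  "commutator_subgroup G X Y = generate G {commutator G x y | x y. x \<in> X \<and> y \<in> Y}"

primrec lower_central_series :: "('g, 'x) monoid_scheme \<Rightarrow> nat \<Rightarrow> 'g set" where
  "lower_central_series G 0 = carrier G"
| "lower_central_series G (Suc n) = commutator_subgroup G (lower_central_series G n) (carrier G)"

definition nilpotent_group :: "('g, 'x) monoid_scheme \<Rightarrow> bool" where
  "nilpotent_group G \<longleftrightarrow> group G \<and> (\<exists>n. lower_central_series G n = {\<one>\<^bsub>G\<^esub>})"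

definition finitely_generated_group :: "('g, 'x) monoid_scheme \<Rightarrow> bool" where
  "finitely_generated_group G \<longleftrightarrow>
     group G \<and> (\<exists>S. finite S \<and> S \<subseteq> carrier G \<and> generate G S = carrier G)"

definition fg_nilpotent_group :: "('g, 'x) monoid_scheme \<Rightarrow> bool" where
  "fg_nilpotent_group G \<longleftrightarrow> finitely_generated_group G \<and> nilpotent_group G"

subsection \<open>The indexing monoid\<close>

text \<open>The indexing monoid is the whole type \<open>'m\<close>; its pre-order is an explicit relation, so
  that nothing identifies it with an order already present on \<open>'m\<close>.\<close>

definition add_submonoid :: "'m::comm_monoid_add set \<Rightarrow> bool" where
  "add_submonoid S \<longleftrightarrow> 0 \<in> S \<and> (\<forall>x\<in>S. \<forall>y\<in>S. x + y \<in> S)"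

definition finitely_generated_monoid :: "'m::comm_monoid_add itself \<Rightarrow> bool" where
  "finitely_generated_monoid _ \<longleftrightarrow> (\<exists>S::'m set. finite S \<and> \<Inter>{N. add_submonoid N \<and> S \<subseteq> N} = UNIV)"

definition conical_preorder :: "('m::comm_monoid_add \<Rightarrow> 'm \<Rightarrow> bool) \<Rightarrow> bool" where
  "conical_preorder prec \<longleftrightarrow>
     reflp prec \<and> transp prec \<and>
     (\<forall>s t s' t'. prec s t \<and> prec s' t' \<longrightarrow> prec (s + s') (t + t')) \<and>
     (\<forall>s. prec 0 s) \<and> (\<forall>s. prec s 0 \<longrightarrow> s = 0)"

subsection \<open>Filters\<close>

definition group_filter ::
  "('m::comm_monoid_add \<Rightarrow> 'm \<Rightarrow> bool) \<Rightarrow> ('g, 'x) monoid_scheme \<Rightarrow> ('m \<Rightarrow> 'g set) \<Rightarrow> bool" where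
  "group_filter prec G \<phi> \<longleftrightarrow>
     (\<forall>s. \<phi> s \<lhd> G) \<and>
     generate G (\<Union>s\<in>-{0}. \<phi> s) = carrier G \<and>
     (\<Inter>s. \<phi> s) = {\<one>\<^bsub>G\<^esub>} \<and>
     (\<forall>s t. commutator_subgroup G (\<phi> s) (\<phi> t) \<subseteq> \<phi> (s + t)) \<and>
     (\<forall>s t. prec s t \<longrightarrow> \<phi> t \<subseteq> \<phi> s)"

definition finite_filter :: "('m \<Rightarrow> 'g set) \<Rightarrow> bool" where
  "finite_filter \<phi> \<longleftrightarrow> finite (range \<phi>)"

definition boundary ::
  "('g, 'x) monoid_scheme \<Rightarrow> ('m::comm_monoid_add \<Rightarrow> 'g set) \<Rightarrow> 'm \<Rightarrow> 'g set" where
  "boundary G \<phi> s = generate G (\<Union>t\<in>-{0}. \<phi> (s + t))"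

primrec inertia_level ::
  "('g, 'x) monoid_scheme \<Rightarrow> ('m::comm_monoid_add \<Rightarrow> 'g set) \<Rightarrow> nat \<Rightarrow> 'g set set" where
  "inertia_level G \<phi> 0 = {{\<one>\<^bsub>G\<^esub>}}"
| "inertia_level G \<phi> (Suc i) =
     {\<phi> s | s. \<exists>B \<subseteq> inertia_level G \<phi> i. boundary G \<phi> s = generate G (\<Union>B)}"

definition inertia_free ::
  "('g, 'x) monoid_scheme \<Rightarrow> ('m::comm_monoid_add \<Rightarrow> 'g set) \<Rightarrow> bool" where
  "inertia_free G \<phi> \<longleftrightarrow> (\<Union>i. inertia_level G \<phi> i) = range \<phi>"

inductive_set filter_lattice ::
  "('g, 'x) monoid_scheme \<Rightarrow> ('m \<Rightarrow> 'g set) \<Rightarrow> 'g set set"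
  for G :: "('g, 'x) monoid_scheme" and \<phi> :: "'m \<Rightarrow> 'g set" where
  base: "\<phi> s \<in> filter_lattice G \<phi>"
| inter: "H \<in> filter_lattice G \<phi> \<Longrightarrow> K \<in> filter_lattice G \<phi> \<Longrightarrow> H \<inter> K \<in> filter_lattice G \<phi>"
| prod: "H \<in> filter_lattice G \<phi> \<Longrightarrow> K \<in> filter_lattice G \<phi> \<Longrightarrow> H <#>\<^bsub>G\<^esub> K \<in> filter_lattice G \<phi>"

definition faithful_filter ::
  "('g, 'x) monoid_scheme \<Rightarrow> ('m::comm_monoid_add \<Rightarrow> 'g set) \<Rightarrow> bool" where
  "faithful_filter G \<phi> \<longleftrightarrow> (\<exists>X \<subseteq> carrier G.
     (\<forall>H\<in>filter_lattice G \<phi>. generate G (H \<inter> X) = H) \<and>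
     inj_on (\<lambda>H. H \<inter> X) (filter_lattice G \<phi>) \<and>
     (\<forall>H\<in>filter_lattice G \<phi>. \<forall>K\<in>filter_lattice G \<phi>.
        (H \<inter> K) \<inter> X = (H \<inter> X) \<inter> (K \<inter> X) \<and>
        (H <#>\<^bsub>G\<^esub> K) \<inter> X = (H \<inter> X) \<union> (K \<inter> X)) \<and>
     (\<forall>x\<in>X. \<exists>!s. x \<in> \<phi> s - boundary G \<phi> s))"

subsection \<open>Filter functors\<close>

text \<open>The underlying category consists of the finitely generated nilpotent groups with elements
  in an arbitrary type \<open>'g\<close>. Functoriality on morphisms is automatic, as a homomorphism is
  sent to itself.\<close>

definition filter_functor ::
  "('m::comm_monoid_add \<Rightarrow> 'm \<Rightarrow> bool) \<Rightarrow> ('g monoid \<Rightarrow> 'm \<Rightarrow> 'g set) \<Rightarrow> bool" where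
  "filter_functor prec \<phi> \<longleftrightarrow>
     (\<forall>G. fg_nilpotent_group G \<longrightarrow> group_filter prec G (\<phi> G)) \<and>
     (\<forall>G H \<alpha>. fg_nilpotent_group G \<and> fg_nilpotent_group H \<and> \<alpha> \<in> hom G H \<longrightarrow>
        (\<forall>s. \<alpha> ` \<phi> G s \<subseteq> \<phi> H s))"

subsection \<open>The graded Lie ring of a filter\<close>

definition filter_quotient ::
  "('g, 'x) monoid_scheme \<Rightarrow> ('m::comm_monoid_add \<Rightarrow> 'g set) \<Rightarrow> 'm \<Rightarrow> 'g set monoid" where
  "filter_quotient G \<phi> s = (G\<lparr>carrier := \<phi> s\<rparr>) Mod (boundary G \<phi> s)"

text \<open>The bracket of two cosets is written as the union over all representatives; by
  \<open>coset_bracket_eq\<close> below every pair of representatives gives the same coset.\<close>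

definition coset_bracket ::
  "('g, 'x) monoid_scheme \<Rightarrow> ('m::comm_monoid_add \<Rightarrow> 'g set) \<Rightarrow> 'm \<Rightarrow> 'm
    \<Rightarrow> 'g set \<Rightarrow> 'g set \<Rightarrow> 'g set" where
  "coset_bracket G \<phi> s t A B = (\<Union>x\<in>A. \<Union>y\<in>B. boundary G \<phi> (s + t) #>\<^bsub>G\<^esub> commutator G x y)"

text \<open>The additive group of a Lie ring is the underlying \<open>monoid\<close> record.\<close>

record 'a lie_ring = "'a monoid" +
  lie_bracket :: "'a \<Rightarrow> 'a \<Rightarrow> 'a"

text \<open>Elements are finitely supported families indexed by the non-zero degrees, and the bracket
  is the biadditive extension of the bracket of homogeneous elements.\<close>

definition graded_lie_ring ::
  "('g, 'x) monoid_scheme \<Rightarrow> ('m::comm_monoid_add \<Rightarrow> 'g set) \<Rightarrow> ('m \<Rightarrow> 'g set) lie_ring" where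
  "graded_lie_ring G \<phi> = monoid.extend (sum_group (-{0}) (filter_quotient G \<phi>))
     (lie_ring.fields (\<lambda>f g. \<lambda>u\<in>-{0}.
        finprod (filter_quotient G \<phi> u) (\<lambda>(s, t). coset_bracket G \<phi> s t (f s) (g t))
          {(s, t). s \<noteq> 0 \<and> t \<noteq> 0 \<and> s + t = u \<and>
             f s \<noteq> \<one>\<^bsub>filter_quotient G \<phi> s\<^esub> \<and> g t \<noteq> \<one>\<^bsub>filter_quotient G \<phi> t\<^esub>}))"

definition homogeneous_component ::
  "('g, 'x) monoid_scheme \<Rightarrow> ('m::comm_monoid_add \<Rightarrow> 'g set) \<Rightarrow> 'm \<Rightarrow> ('m \<Rightarrow> 'g set) set" where
  "homogeneous_component G \<phi> s =
     {f \<in> carrier (graded_lie_ring G \<phi>). \<forall>t. t \<noteq> 0 \<and> t \<noteq> s \<longrightarrow> f t = \<one>\<^bsub>filter_quotient G \<phi> t\<^esub>}"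

definition graded_lie_ring_iso ::
  "('g, 'x) monoid_scheme \<Rightarrow> ('m::comm_monoid_add \<Rightarrow> 'g set) \<Rightarrow>
   ('h, 'y) monoid_scheme \<Rightarrow> ('m \<Rightarrow> 'h set) \<Rightarrow> (('m \<Rightarrow> 'g set) \<Rightarrow> ('m \<Rightarrow> 'h set)) \<Rightarrow> bool" where
  "graded_lie_ring_iso G \<phi> H \<theta> \<beta> \<longleftrightarrow>
     \<beta> \<in> iso (graded_lie_ring G \<phi>) (graded_lie_ring H \<theta>) \<and>
     (\<forall>f\<in>carrier (graded_lie_ring G \<phi>). \<forall>g\<in>carrier (graded_lie_ring G \<phi>).
        \<beta> (lie_bracket (graded_lie_ring G \<phi>) f g)
          = lie_bracket (graded_lie_ring H \<theta>) (\<beta> f) (\<beta> g)) \<and>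
     (\<forall>s. s \<noteq> 0 \<longrightarrow> \<beta> ` homogeneous_component G \<phi> s = homogeneous_component H \<theta> s)"

subsection \<open>Lifts\<close>

definition homogeneous_element ::
  "('g, 'x) monoid_scheme \<Rightarrow> ('m::comm_monoid_add \<Rightarrow> 'g set) \<Rightarrow> 'm \<Rightarrow> 'g set \<Rightarrow> ('m \<Rightarrow> 'g set)" where
  "homogeneous_element G \<phi> s c =
     (\<lambda>t\<in>-{0}. if t = s then c else \<one>\<^bsub>filter_quotient G \<phi> t\<^esub>)"

text \<open>The map that \<open>\<beta>\<close> induces from degree \<open>s\<close> to degree \<open>s\<close>. The Lie ring has no
  degree \<open>0\<close>, where the quotients \<open>\<phi> 0 / boundary G \<phi> 0\<close> and \<open>\<theta> 0 / boundary H \<theta> 0\<close>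
  are trivial groups; the map between them is the only possible one.\<close>

definition degree_map ::
  "('g, 'x) monoid_scheme \<Rightarrow> ('m::comm_monoid_add \<Rightarrow> 'g set) \<Rightarrow>
   ('h, 'y) monoid_scheme \<Rightarrow> ('m \<Rightarrow> 'h set) \<Rightarrow> (('m \<Rightarrow> 'g set) \<Rightarrow> ('m \<Rightarrow> 'h set)) \<Rightarrow>
   'm \<Rightarrow> 'g set \<Rightarrow> 'h set" where
  "degree_map G \<phi> H \<theta> \<beta> s c =
     (if s = 0 then \<one>\<^bsub>filter_quotient H \<theta> 0\<^esub> else \<beta> (homogeneous_element G \<phi> s c) s)"

definition support_index ::
  "('g, 'x) monoid_scheme \<Rightarrow> ('m::comm_monoid_add \<Rightarrow> 'g set) \<Rightarrow> 'm set" where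
  "support_index G \<phi> = {s. boundary G \<phi> s \<noteq> \<phi> s \<or> \<phi> s = {\<one>\<^bsub>G\<^esub>}}"

definition transversal ::
  "('g, 'x) monoid_scheme \<Rightarrow> ('m::comm_monoid_add \<Rightarrow> 'g set) \<Rightarrow> 'm \<Rightarrow> ('g set \<Rightarrow> 'g) \<Rightarrow> bool" where
  "transversal G \<phi> s \<tau> \<longleftrightarrow>
     (\<forall>c\<in>carrier (filter_quotient G \<phi> s). \<tau> c \<in> \<phi> s \<and> boundary G \<phi> s #>\<^bsub>G\<^esub> \<tau> c = c)"

text \<open>A partial lift is defined on the disjoint union of the sets \<open>\<X> s\<close>, so it takes the degree
  \<open>s\<close> as an argument next to the element \<open>x\<close> of \<open>\<X> s\<close>.\<close>

definition partial_lift ::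
  "('g, 'x) monoid_scheme \<Rightarrow> ('m::comm_monoid_add \<Rightarrow> 'g set) \<Rightarrow>
   ('h, 'y) monoid_scheme \<Rightarrow> ('m \<Rightarrow> 'h set) \<Rightarrow> (('m \<Rightarrow> 'g set) \<Rightarrow> ('m \<Rightarrow> 'h set)) \<Rightarrow>
   ('m \<Rightarrow> 'h set \<Rightarrow> 'h) \<Rightarrow> 'm \<Rightarrow> 'g \<Rightarrow> 'h" where
  "partial_lift G \<phi> H \<theta> \<beta> \<sigma> s x = \<sigma> s (degree_map G \<phi> H \<theta> \<beta> s (boundary G \<phi> s #>\<^bsub>G\<^esub> x))"

definition is_lift ::
  "('g, 'x) monoid_scheme \<Rightarrow> ('m::comm_monoid_add \<Rightarrow> 'g set) \<Rightarrow>
   ('h, 'y) monoid_scheme \<Rightarrow> ('m \<Rightarrow> 'h set) \<Rightarrow> (('m \<Rightarrow> 'g set) \<Rightarrow> ('m \<Rightarrow> 'h set)) \<Rightarrow>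
   ('g \<Rightarrow> 'h) \<Rightarrow> bool" where
  "is_lift G \<phi> H \<theta> \<beta> \<alpha> \<longleftrightarrow>
     \<alpha> \<in> hom G H \<and>
     (\<exists>\<tau> \<sigma> Y \<X>.
        (\<forall>s. transversal G \<phi> s (\<tau> s)) \<and>
        (\<forall>s. transversal H \<theta> s (\<sigma> s)) \<and>
        (\<forall>s. Y s \<subseteq> carrier (filter_quotient G \<phi> s) \<and>
           generate (filter_quotient G \<phi> s) (Y s) = carrier (filter_quotient G \<phi> s)) \<and>
        (\<forall>s. \<X> s = \<tau> s ` Y s) \<and>
        generate G (\<Union>s\<in>support_index G \<phi>. \<X> s) = carrier G \<and>
        (\<forall>s\<in>support_index G \<phi>. \<forall>x\<in>\<X> s. \<alpha> x = partial_lift G \<phi> H \<theta> \<beta> \<sigma> s x))"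

subsection \<open>Well-definedness of the bracket\<close>

context group
begin

lemma commutator_closed [simp]:
  "x \<in> carrier G \<Longrightarrow> y \<in> carrier G \<Longrightarrow> commutator G x y \<in> carrier G"
  by (simp add: commutator_def)

lemma commutator_eq_one_iff:
  assumes "x \<in> carrier G" "y \<in> carrier G"
  shows "commutator G x y = \<one> \<longleftrightarrow> x \<otimes> y = y \<otimes> x"
proof -
  have "commutator G x y = inv (y \<otimes> x) \<otimes> (x \<otimes> y)"
    using assms by (simp add: commutator_def inv_mult_group m_assoc)
  then show ?thesis
    using inv_solve_left[of \<one> "y \<otimes> x" "x \<otimes> y"] r_one[of "y \<otimes> x"] assms
    by (metis m_closed one_closed)
qed

lemma commutator_mult_commuting:
  assumes c: "a \<in> carrier G" "x \<in> carrier G" "b \<in> carrier G" "y \<in> carrier G"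
    and comm: "a \<otimes> b = b \<otimes> a" "a \<otimes> y = y \<otimes> a" "b \<otimes> x = x \<otimes> b"
  shows "commutator G (a \<otimes> x) (b \<otimes> y) = commutator G x y"
proof -
  have "(b \<otimes> y) \<otimes> (a \<otimes> x) = (b \<otimes> a) \<otimes> (y \<otimes> x)"
    using c comm by (metis m_assoc m_closed)
  moreover have "(a \<otimes> x) \<otimes> (b \<otimes> y) = (b \<otimes> a) \<otimes> (x \<otimes> y)"
    using c comm by (metis m_assoc m_closed)
  moreover have "commutator G u v = inv (v \<otimes> u) \<otimes> (u \<otimes> v)"
    if "u \<in> carrier G" "v \<in> carrier G" for u v
    using that by (simp add: commutator_def inv_mult_group m_assoc)
  ultimately have "commutator G (a \<otimes> x) (b \<otimes> y)
      = inv ((b \<otimes> a) \<otimes> (y \<otimes> x)) \<otimes> ((b \<otimes> a) \<otimes> (x \<otimes> y))"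
    using c by simp
  also have "\<dots> = inv (y \<otimes> x) \<otimes> (inv (b \<otimes> a) \<otimes> (b \<otimes> a)) \<otimes> (x \<otimes> y)"
    using c by (simp add: inv_mult_group m_assoc del: l_inv)
  also have "\<dots> = inv (y \<otimes> x) \<otimes> (x \<otimes> y)"
    using c by (subst l_inv) auto
  also have "\<dots> = commutator G x y"
    using c by (simp add: commutator_def inv_mult_group m_assoc)
  finally show ?thesis .
qed

lemma commute_inv:
  assumes "a \<in> carrier G" "y \<in> carrier G" "a \<otimes> y = y \<otimes> a"
  shows "inv a \<otimes> y = y \<otimes> inv a"
  using assms by (metis inv_closed inv_solve_left inv_solve_right m_assoc m_closed)

lemma normal_generate_Union:
  assumes "\<And>i. i \<in> I \<Longrightarrow> N i \<lhd> G"
  shows "generate G (\<Union>i\<in>I. N i) \<lhd> G"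
proof (rule normal_generateI)
  show "(\<Union>i\<in>I. N i) \<subseteq> carrier G"
    using assms by (meson UN_least normal_imp_subgroup subgroup.subset)
  show "g \<otimes> h \<otimes> inv g \<in> (\<Union>i\<in>I. N i)" if "h \<in> (\<Union>i\<in>I. N i)" "g \<in> carrier G" for h g
    using that assms by (auto intro: normal.inv_op_closed2)
qed

end

lemma (in group_hom) hom_commutator:
  assumes "x \<in> carrier G" "y \<in> carrier G"
  shows "h (commutator G x y) = commutator H (h x) (h y)"
  using assms by (simp add: commutator_def)

lemma boundary_normal:
  assumes "group G" "group_filter prec G \<phi>"
  shows "boundary G \<phi> s \<lhd> G"
  unfolding boundary_def
  using assms by (intro group.normal_generate_Union) (auto simp: group_filter_def)

lemma boundary_commutes_mod_boundary:
  assumes G: "group G" and F: "group_filter prec G \<phi>"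
    and a: "a \<in> boundary G \<phi> s" and y: "y \<in> \<phi> t"
  defines "N \<equiv> boundary G \<phi> (s + t)"
  shows "(N #>\<^bsub>G\<^esub> a) \<otimes>\<^bsub>G Mod N\<^esub> (N #>\<^bsub>G\<^esub> y) = (N #>\<^bsub>G\<^esub> y) \<otimes>\<^bsub>G Mod N\<^esub> (N #>\<^bsub>G\<^esub> a)"
proof -
  interpret group G by (rule G)
  have N: "N \<lhd> G" unfolding N_def using G F by (rule boundary_normal)
  interpret N: normal N G by (rule N)
  interpret Q: group "G Mod N" by (rule N.factorgroup_is_group)
  interpret \<pi>: group_hom G "G Mod N" "r_coset G N"
    by unfold_locales (rule N.r_coset_hom_Mod)
  have sub: "\<phi> u \<subseteq> carrier G" for u
    using F by (meson group_filter_def normal_imp_subgroup subgroup.subset)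
  have gens: "(\<Union>v\<in>-{0}. \<phi> (s + v)) \<subseteq> carrier G"
    using sub by blast
  have yc: "y \<in> carrier G" using y sub by blast
  have base: "(N #>\<^bsub>G\<^esub> a) \<otimes>\<^bsub>G Mod N\<^esub> (N #>\<^bsub>G\<^esub> y) = (N #>\<^bsub>G\<^esub> y) \<otimes>\<^bsub>G Mod N\<^esub> (N #>\<^bsub>G\<^esub> a)"
    if a: "a \<in> (\<Union>v\<in>-{0}. \<phi> (s + v))" for a
  proof -
    obtain v where v: "v \<noteq> 0" "a \<in> \<phi> (s + v)" using a by blast
    have ac: "a \<in> carrier G" using v sub by blast
    have "commutator G a y \<in> commutator_subgroup G (\<phi> (s + v)) (\<phi> t)"
      unfolding commutator_subgroup_def using v y by (blast intro: generate.incl)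
    then have "commutator G a y \<in> \<phi> (s + v + t)"
      using F unfolding group_filter_def by (meson subsetD)
    then have "commutator G a y \<in> N"
      unfolding N_def boundary_def using v
      by (intro generate.incl UN_I[of v]) (simp_all add: ac_simps)
    then have "commutator (G Mod N) (N #>\<^bsub>G\<^esub> a) (N #>\<^bsub>G\<^esub> y) = \<one>\<^bsub>G Mod N\<^esub>"
      using ac yc by (metis N.rcos_const \<pi>.hom_commutator is_group one_FactGroup)
    then show ?thesis
      using Q.commutator_eq_one_iff ac yc \<pi>.hom_closed by blast
  qed
  have "a \<in> carrier G \<and> (N #>\<^bsub>G\<^esub> a) \<otimes>\<^bsub>G Mod N\<^esub> (N #>\<^bsub>G\<^esub> y) = (N #>\<^bsub>G\<^esub> y) \<otimes>\<^bsub>G Mod N\<^esub> (N #>\<^bsub>G\<^esub> a)"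
    using a unfolding boundary_def
  proof (induction rule: generate.induct)
    case one
    have "(\<one>\<^bsub>G Mod N\<^esub>) \<otimes>\<^bsub>G Mod N\<^esub> (N #>\<^bsub>G\<^esub> y) = (N #>\<^bsub>G\<^esub> y) \<otimes>\<^bsub>G Mod N\<^esub> \<one>\<^bsub>G Mod N\<^esub>"
      using Q.l_one Q.r_one \<pi>.hom_closed[OF yc] by metis
    then show ?case by (metis \<pi>.hom_one one_closed)
  next
    case (incl h)
    then show ?case using base gens by blast
  next
    case (inv h)
    then have h: "h \<in> carrier G" using gens by blast
    show ?case
      using Q.commute_inv[OF \<pi>.hom_closed[OF h] \<pi>.hom_closed[OF yc] base[OF inv]]
      unfolding \<pi>.hom_inv[OF h] using h by simp
  next
    case (eng h1 h2)
    let ?Q = "G Mod N" and ?p = "\<lambda>z. N #>\<^bsub>G\<^esub> z"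
    have c: "?p h1 \<in> carrier ?Q" "?p h2 \<in> carrier ?Q" "?p y \<in> carrier ?Q"
      using eng.IH yc \<pi>.hom_closed by blast+
    have e: "?p h1 \<otimes>\<^bsub>?Q\<^esub> ?p y = ?p y \<otimes>\<^bsub>?Q\<^esub> ?p h1" "?p h2 \<otimes>\<^bsub>?Q\<^esub> ?p y = ?p y \<otimes>\<^bsub>?Q\<^esub> ?p h2"
      using eng.IH by blast+
    have "(?p h1 \<otimes>\<^bsub>?Q\<^esub> ?p h2) \<otimes>\<^bsub>?Q\<^esub> ?p y = ?p y \<otimes>\<^bsub>?Q\<^esub> (?p h1 \<otimes>\<^bsub>?Q\<^esub> ?p h2)"
      using Q.m_assoc[OF c] Q.m_assoc[OF c(1,3,2)] Q.m_assoc[OF c(3,1,2)] e by simp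
    then show ?case
      using eng.IH \<pi>.hom_mult m_closed by simp
  qed
  then show ?thesis ..
qed

lemma coset_bracket_eq:
  assumes G: "group G" and C: "conical_preorder prec" and F: "group_filter prec G \<phi>"
    and x: "x \<in> \<phi> s" and y: "y \<in> \<phi> t"
  shows "coset_bracket G \<phi> s t (boundary G \<phi> s #>\<^bsub>G\<^esub> x) (boundary G \<phi> t #>\<^bsub>G\<^esub> y)
           = boundary G \<phi> (s + t) #>\<^bsub>G\<^esub> commutator G x y"
proof -
  interpret group G by (rule G)
  define N where "N = boundary G \<phi> (s + t)"
  have N: "N \<lhd> G" unfolding N_def using G F by (rule boundary_normal)
  interpret N: normal N G by (rule N)
  interpret Q: group "G Mod N" by (rule N.factorgroup_is_group)
  interpret \<pi>: group_hom G "G Mod N" "r_coset G N"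
    by unfold_locales (rule N.r_coset_hom_Mod)
  have sub: "\<phi> u \<subseteq> carrier G" for u
    using F by (meson group_filter_def normal_imp_subgroup subgroup.subset)
  have bsub: "subgroup (boundary G \<phi> u) G" for u
    using boundary_normal[OF G F] normal_imp_subgroup by blast
  have mono: "\<phi> (u + v) \<subseteq> \<phi> u" for u v
  proof -
    have "prec (u + 0) (u + v)"
      using C unfolding conical_preorder_def reflp_def by blast
    then show ?thesis using F by (simp add: group_filter_def)
  qed
  have bt: "boundary G \<phi> u \<subseteq> \<phi> u" for u
    unfolding boundary_def
  proof (rule generate_subgroup_incl)
    show "(\<Union>v\<in>-{0}. \<phi> (u + v)) \<subseteq> \<phi> u" using mono by blast
    show "subgroup (\<phi> u) G" using F by (simp add: group_filter_def normal_imp_subgroup)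
  qed
  have eq: "N #>\<^bsub>G\<^esub> commutator G (a \<otimes>\<^bsub>G\<^esub> x) (b \<otimes>\<^bsub>G\<^esub> y) = N #>\<^bsub>G\<^esub> commutator G x y"
    if a: "a \<in> boundary G \<phi> s" and b: "b \<in> boundary G \<phi> t" for a b
  proof -
    have bb: "b \<in> \<phi> t" using b bt by blast
    have c: "a \<in> carrier G" "b \<in> carrier G" "x \<in> carrier G" "y \<in> carrier G"
      using a b x y sub bsub by (auto dest: subgroup.mem_carrier)
    have "commutator (G Mod N) ((N #>\<^bsub>G\<^esub> a) \<otimes>\<^bsub>G Mod N\<^esub> (N #>\<^bsub>G\<^esub> x)) ((N #>\<^bsub>G\<^esub> b) \<otimes>\<^bsub>G Mod N\<^esub> (N #>\<^bsub>G\<^esub> y))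
        = commutator (G Mod N) (N #>\<^bsub>G\<^esub> x) (N #>\<^bsub>G\<^esub> y)"
    proof (rule Q.commutator_mult_commuting)
      show "(N #>\<^bsub>G\<^esub> a) \<otimes>\<^bsub>G Mod N\<^esub> (N #>\<^bsub>G\<^esub> b) = (N #>\<^bsub>G\<^esub> b) \<otimes>\<^bsub>G Mod N\<^esub> (N #>\<^bsub>G\<^esub> a)"
        unfolding N_def by (rule boundary_commutes_mod_boundary[OF G F a bb])
      show "(N #>\<^bsub>G\<^esub> a) \<otimes>\<^bsub>G Mod N\<^esub> (N #>\<^bsub>G\<^esub> y) = (N #>\<^bsub>G\<^esub> y) \<otimes>\<^bsub>G Mod N\<^esub> (N #>\<^bsub>G\<^esub> a)"
        unfolding N_def by (rule boundary_commutes_mod_boundary[OF G F a y])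
      show "(N #>\<^bsub>G\<^esub> b) \<otimes>\<^bsub>G Mod N\<^esub> (N #>\<^bsub>G\<^esub> x) = (N #>\<^bsub>G\<^esub> x) \<otimes>\<^bsub>G Mod N\<^esub> (N #>\<^bsub>G\<^esub> b)"
        unfolding N_def
        using boundary_commutes_mod_boundary[OF G F b x] by (simp add: add.commute)
    qed (use c \<pi>.hom_closed in blast)+
    then show ?thesis
      using c by (metis \<pi>.hom_commutator \<pi>.hom_mult m_closed)
  qed
  have "boundary G \<phi> u \<noteq> {}" for u
    using bsub subgroup.one_closed by blast
  then show ?thesis
    using eq unfolding coset_bracket_def N_def[symmetric] r_coset_def[of G "boundary G \<phi> s"]
      r_coset_def[of G "boundary G \<phi> t"]
    by auto
qed

end

theory Submission
  imports Defs
begin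

text \<open>
  Functoriality, applied to an isomorphism \<open>\<alpha> : G \<rightarrow> H\<close> and to its inverse, shows that \<open>\<alpha>\<close> carries
  each \<open>\<phi> G s\<close> \<^emph>\<open>onto\<close> \<open>\<phi> H s\<close> (\<open>filter_functor_image_iso\<close>). The boundaries are built from these
  subgroups alone, so \<open>\<alpha>\<close> also identifies boundaries and cosets of boundaries, and thereby induces an
  isomorphism of each homogeneous quotient. Commutators commute with homomorphisms, so the sum of
  these maps respects the bracket: this is \<open>graded_map\<close>, the graded Lie ring isomorphism that
  \<open>\<alpha>\<close> lifts (\<open>graded_map_graded_lie_ring_iso\<close>).

  To see that \<open>\<alpha>\<close> is a lift of it (\<open>is_lift_graded_map\<close>), take any transversals \<open>\<tau> s\<close> on the side
  of \<open>G\<close> and transport them along \<open>\<alpha>\<close> to transversals \<open>\<sigma> s\<close> on the side of \<open>H\<close>. The partial lift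
  for these choices is then the restriction of \<open>\<alpha>\<close>, tautologically. What has substance is
  that the chosen representatives generate \<open>G\<close> (\<open>generate_transversals\<close>). Modulo the boundary of \<open>\<phi> s\<close>
  they generate \<open>\<phi> s\<close>, but a descent through successive boundaries can in general stall at a
  non-trivial subgroup that is its own boundary. Inertia-freeness is exactly the well-foundedness needed: every \<open>\<phi> s\<close> is reached from
  the trivial subgroup in finitely many steps, each passing from a boundary that is already generated to the
  filter subgroup above it.
\<close>

section \<open>Homomorphisms, finite products and restricted direct sums\<close>

text \<open>An infinite index set is covered by the convention that the product over it is the
  unit. This lets brackets be transported without first bounding the number of
  contributing pairs of degrees.\<close>

lemma hom_finprod:
  assumes A: "comm_group A" and B: "comm_group B" and h: "h \<in> hom A B"
    and f: "f \<in> I \<rightarrow> carrier A"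
  shows "h (finprod A f I) = finprod B (h \<circ> f) I"
proof -
  interpret A: comm_group A by (rule A)
  interpret B: comm_group B by (rule B)
  interpret h: group_hom A B h by unfold_locales (rule h)
  show ?thesis
    using f by (induction I rule: infinite_finite_induct) (auto simp: Pi_iff)
qed

text \<open>Componentwise isomorphisms preserve supports, hence finiteness of supports. The explicit form
  of the map matters: a lift is tied to the components of the graded isomorphism, so the mere
  existence of an isomorphism of the sums would not suffice.\<close>

lemma iso_sum_group_componentwise:
  assumes G: "\<And>i. i \<in> I \<Longrightarrow> group (G i)" and H: "\<And>i. i \<in> I \<Longrightarrow> group (H i)"
    and f: "\<And>i. i \<in> I \<Longrightarrow> f i \<in> iso (G i) (H i)"
  shows "(\<lambda>x. \<lambda>i\<in>I. f i (x i)) \<in> iso (sum_group I G) (sum_group I H)"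
proof (rule isoI)
  have closed: "f i a \<in> carrier (H i)" if "i \<in> I" "a \<in> carrier (G i)" for i a
    using f[OF that(1)] that(2) by (auto simp: iso_def hom_def)
  have inj: "inj_on (f i) (carrier (G i))" and onto: "f i ` carrier (G i) = carrier (H i)"
    if "i \<in> I" for i
    using f[OF that] by (auto simp: iso_def bij_betw_def)
  have one_iff: "f i a = \<one>\<^bsub>H i\<^esub> \<longleftrightarrow> a = \<one>\<^bsub>G i\<^esub>" if "i \<in> I" "a \<in> carrier (G i)" for i a
    using that G H f inj hom_one
    by (metis inj_onD group.subgroup_self iso_imp_homomorphism subgroup.one_closed)
  have supp: "{i \<in> I. f i (x i) \<noteq> \<one>\<^bsub>H i\<^esub>} = {i \<in> I. x i \<noteq> \<one>\<^bsub>G i\<^esub>}"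
    if "x \<in> (\<Pi>\<^sub>E i\<in>I. carrier (G i))" for x
    using that one_iff by (auto simp: PiE_iff)
  show "(\<lambda>x. \<lambda>i\<in>I. f i (x i)) \<in> hom (sum_group I G) (sum_group I H)"
  proof (rule homI)
    fix x assume x: "x \<in> carrier (sum_group I G)"
    then have "x \<in> (\<Pi>\<^sub>E i\<in>I. carrier (G i))" "finite {i \<in> I. x i \<noteq> \<one>\<^bsub>G i\<^esub>}"
      by (simp_all add: carrier_sum_group G)
    then show "(\<lambda>i\<in>I. f i (x i)) \<in> carrier (sum_group I H)"
      using supp[of x] closed by (auto simp: carrier_sum_group H PiE_iff cong: conj_cong)
  next
    fix x y assume "x \<in> carrier (sum_group I G)" "y \<in> carrier (sum_group I G)"
    then show "(\<lambda>i\<in>I. f i ((x \<otimes>\<^bsub>sum_group I G\<^esub> y) i))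
        = (\<lambda>i\<in>I. f i (x i)) \<otimes>\<^bsub>sum_group I H\<^esub> (\<lambda>i\<in>I. f i (y i))"
      using f by (auto simp: carrier_sum_group G PiE_iff iso_def hom_def intro!: restrict_ext)
  qed
  show "bij_betw (\<lambda>x. \<lambda>i\<in>I. f i (x i)) (carrier (sum_group I G)) (carrier (sum_group I H))"
    unfolding bij_betw_def
  proof (intro conjI subset_antisym subsetI)
    show "inj_on (\<lambda>x. \<lambda>i\<in>I. f i (x i)) (carrier (sum_group I G))"
    proof (rule inj_onI)
      fix x y assume xy: "x \<in> carrier (sum_group I G)" "y \<in> carrier (sum_group I G)"
        and eq: "(\<lambda>i\<in>I. f i (x i)) = (\<lambda>i\<in>I. f i (y i))"
      have xe: "x \<in> (\<Pi>\<^sub>E i\<in>I. carrier (G i))" and ye: "y \<in> (\<Pi>\<^sub>E i\<in>I. carrier (G i))"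
        using xy by (simp_all add: carrier_sum_group G)
      show "x = y"
      proof (rule PiE_ext[OF xe ye])
        fix i assume i: "i \<in> I"
        then have "f i (x i) = f i (y i)" using fun_cong[OF eq, of i] by simp
        then show "x i = y i" using inj[OF i] xe ye i by (auto dest: inj_onD)
      qed
    qed
  next
    fix y assume "y \<in> (\<lambda>x. \<lambda>i\<in>I. f i (x i)) ` carrier (sum_group I G)"
    then obtain x where x: "x \<in> carrier (sum_group I G)" "y = (\<lambda>i\<in>I. f i (x i))" by blast
    then have "x \<in> (\<Pi>\<^sub>E i\<in>I. carrier (G i))" "finite {i \<in> I. x i \<noteq> \<one>\<^bsub>G i\<^esub>}"
      by (simp_all add: carrier_sum_group G)
    then show "y \<in> carrier (sum_group I H)"
      using supp[of x] closed x(2) by (auto simp: carrier_sum_group H PiE_iff cong: conj_cong)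
  next
    fix y assume "y \<in> carrier (sum_group I H)"
    then have y: "y \<in> (\<Pi>\<^sub>E i\<in>I. carrier (H i))" "finite {i \<in> I. y i \<noteq> \<one>\<^bsub>H i\<^esub>}"
      by (simp_all add: carrier_sum_group H)
    define x where "x = (\<lambda>i\<in>I. inv_into (carrier (G i)) (f i) (y i))"
    have x: "x \<in> (\<Pi>\<^sub>E i\<in>I. carrier (G i))"
      using y(1) onto by (auto simp: x_def PiE_iff intro!: inv_into_into)
    have fx: "f i (x i) = y i" if "i \<in> I" for i
      using that y(1) onto by (auto simp: x_def PiE_iff f_inv_into_f)
    then have "{i \<in> I. f i (x i) \<noteq> \<one>\<^bsub>H i\<^esub>} = {i \<in> I. y i \<noteq> \<one>\<^bsub>H i\<^esub>}"
      by (simp cong: conj_cong)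
    then have "{i \<in> I. x i \<noteq> \<one>\<^bsub>G i\<^esub>} = {i \<in> I. y i \<noteq> \<one>\<^bsub>H i\<^esub>}"
      using supp[OF x] by simp
    then have "x \<in> carrier (sum_group I G)"
      using x y(2) by (simp add: carrier_sum_group G)
    moreover have "y = (\<lambda>i\<in>I. f i (x i))"
      using fx y(1) by (auto simp: PiE_iff extensional_def fun_eq_iff)
    ultimately show "y \<in> (\<lambda>x. \<lambda>i\<in>I. f i (x i)) ` carrier (sum_group I G)" by blast
  qed
qed

section \<open>Filtered groups and their graded quotients\<close>

locale filtered_group = group G for G (structure) +
  fixes prec :: "'m::comm_monoid_add \<Rightarrow> 'm \<Rightarrow> bool" and \<phi> :: "'m \<Rightarrow> 'a set"
  assumes conical: "conical_preorder prec" and filter: "group_filter prec G \<phi>"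
begin

lemma filter_normal: "\<phi> s \<lhd> G"
  using filter by (simp add: group_filter_def)

lemma filter_subgroup: "subgroup (\<phi> s) G"
  using filter_normal by (rule normal_imp_subgroup)

lemma filter_subset: "\<phi> s \<subseteq> carrier G"
  using filter_subgroup by (rule subgroup.subset)

lemma filter_antimono_add: "\<phi> (s + t) \<subseteq> \<phi> s"
proof -
  have "prec (s + 0) (s + t)"
    using conical unfolding conical_preorder_def reflp_def by blast
  then show ?thesis using filter by (simp add: group_filter_def)
qed

lemma boundary_normal_filter: "boundary G \<phi> s \<lhd> G"
  using boundary_normal[OF is_group filter] .

lemma boundary_subgroup: "subgroup (boundary G \<phi> s) G"
  using boundary_normal_filter by (rule normal_imp_subgroup)

lemma boundary_subset_filter: "boundary G \<phi> s \<subseteq> \<phi> s"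
  unfolding boundary_def
  using filter_antimono_add by (intro generate_subgroup_incl[OF _ filter_subgroup]) blast

lemma boundary_subset: "boundary G \<phi> s \<subseteq> carrier G"
  using boundary_subset_filter filter_subset by blast

lemma filter_add_subset_boundary: "t \<noteq> 0 \<Longrightarrow> \<phi> (s + t) \<subseteq> boundary G \<phi> s"
  unfolding boundary_def by (blast intro: generate.incl)

text \<open>In degree \<open>0\<close> the boundary is the subgroup generated by the whole filter in non-zero degrees,
  so the degree \<open>0\<close> quotient is trivial.\<close>

lemma boundary_zero: "boundary G \<phi> 0 = carrier G"
  using filter by (simp add: boundary_def group_filter_def)

lemma filter_zero: "\<phi> 0 = carrier G"
  using boundary_zero boundary_subset_filter filter_subset by blast

lemma commutator_mem_filter:
  "x \<in> \<phi> s \<Longrightarrow> y \<in> \<phi> t \<Longrightarrow> commutator G x y \<in> \<phi> (s + t)"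
  using filter unfolding group_filter_def commutator_subgroup_def
  by (blast intro: generate.incl)

lemma carrier_filter_quotient:
  "carrier (filter_quotient G \<phi> s) = (\<lambda>x. boundary G \<phi> s #> x) ` \<phi> s"
  by (simp add: filter_quotient_def carrier_FactGroup r_coset_def)

lemma one_filter_quotient: "\<one>\<^bsub>filter_quotient G \<phi> s\<^esub> = boundary G \<phi> s"
  by (simp add: filter_quotient_def)

lemma mult_filter_quotient: "A \<otimes>\<^bsub>filter_quotient G \<phi> s\<^esub> B = A <#> B"
  by (simp add: filter_quotient_def set_mult_def)

lemma group_filter_quotient: "group (filter_quotient G \<phi> s)"
  unfolding filter_quotient_def
  by (intro normal.factorgroup_is_group normal_restrict_supergroup filter_subgroup
      boundary_normal_filter boundary_subset_filter)

lemma filter_quotient_coset_subset: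
  "c \<in> carrier (filter_quotient G \<phi> s) \<Longrightarrow> c \<subseteq> carrier G"
  unfolding carrier_filter_quotient
  using r_coset_subset_G[OF boundary_subset] filter_subset by blast

text \<open>The commutator of two elements of \<open>\<phi> s\<close> lies in \<open>\<phi> (s + s)\<close>, which is part of the boundary
  as soon as \<open>s \<noteq> 0\<close>. Commutativity is what makes the finite product in the definition of the
  bracket meaningful.\<close>

lemma comm_group_filter_quotient:
  assumes "s \<noteq> 0"
  shows "comm_group (filter_quotient G \<phi> s)"
proof (rule group.group_comm_groupI[OF group_filter_quotient])
  fix A B assume "A \<in> carrier (filter_quotient G \<phi> s)" "B \<in> carrier (filter_quotient G \<phi> s)"
  then obtain x y where x: "x \<in> \<phi> s" "A = boundary G \<phi> s #> x"
    and y: "y \<in> \<phi> s" "B = boundary G \<phi> s #> y"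
    by (auto simp: carrier_filter_quotient)
  have c: "x \<in> carrier G" "y \<in> carrier G" using x y filter_subset by auto
  \<comment> \<open>With inverted arguments, \<open>z = x y x\<inverse> y\<inverse>\<close> is the left factor in \<open>x y = z (y x)\<close>, as right
    cosets require.\<close>
  define z where "z = commutator G (inv x) (inv y)"
  have z: "z \<in> boundary G \<phi> s" unfolding z_def
    using commutator_mem_filter subgroup.m_inv_closed[OF filter_subgroup] x y
      filter_add_subset_boundary[OF assms] by blast
  have "x \<otimes> y = z \<otimes> (y \<otimes> x)"
    using c by (simp add: z_def commutator_def m_assoc inv_solve_left')
  then have "x \<otimes> y \<in> boundary G \<phi> s #> (y \<otimes> x)"
    using z by (auto simp: r_coset_def)
  then have "boundary G \<phi> s #> (y \<otimes> x) = boundary G \<phi> s #> (x \<otimes> y)"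
    using c by (intro repr_independence boundary_subgroup) auto
  then show "A \<otimes>\<^bsub>filter_quotient G \<phi> s\<^esub> B = B \<otimes>\<^bsub>filter_quotient G \<phi> s\<^esub> A"
    using c x y by (simp add: mult_filter_quotient normal.rcos_sum[OF boundary_normal_filter])
qed

lemma coset_bracket_closed:
  assumes "A \<in> carrier (filter_quotient G \<phi> s)" "B \<in> carrier (filter_quotient G \<phi> t)"
  shows "coset_bracket G \<phi> s t A B \<in> carrier (filter_quotient G \<phi> (s + t))"
  using assms coset_bracket_eq[OF is_group conical filter] commutator_mem_filter
  by (fastforce simp: carrier_filter_quotient)

lemma carrier_graded_lie_ring:
  "carrier (graded_lie_ring G \<phi>) =
     {f \<in> \<Pi>\<^sub>E s\<in>-{0}. carrier (filter_quotient G \<phi> s). finite {s \<in> -{0}. f s \<noteq> boundary G \<phi> s}}"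
  by (simp add: graded_lie_ring_def monoid.extend_def lie_ring.fields_def carrier_sum_group
      group_filter_quotient one_filter_quotient)

text \<open>Induction on the inertia level. If the boundary of \<open>\<phi> s\<close> is already generated, so is \<open>\<phi> s\<close>:
  either \<open>s\<close> is a support index and every element of \<open>\<phi> s\<close> is a boundary element times a
  representative, or \<open>\<phi> s\<close> equals its boundary. A subgroup of level \<open>i + 1\<close> has the form
  \<open>\<phi> s\<close> for some \<open>s\<close> whose boundary is generated by subgroups of level \<open>i\<close>, and by
  inertia-freeness the whole group \<open>\<phi> 0\<close> has some level.\<close>

lemma generate_transversals:
  assumes inertia: "inertia_free G \<phi>" and \<tau>: "\<And>s. transversal G \<phi> s (\<tau> s)"
  shows "generate G (\<Union>s\<in>support_index G \<phi>. \<tau> s ` carrier (filter_quotient G \<phi> s)) = carrier G"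
    (is "generate G ?X = _")
proof -
  have X: "?X \<subseteq> carrier G"
    using \<tau> filter_subset unfolding transversal_def by blast
  have K: "subgroup (generate G ?X) G" using X by (rule generate_is_subgroup)
  have step: "\<phi> s \<subseteq> generate G ?X" if b: "boundary G \<phi> s \<subseteq> generate G ?X" for s
  proof (cases "s \<in> support_index G \<phi>")
    case True
    show ?thesis
    proof
      fix x assume x: "x \<in> \<phi> s"
      let ?c = "boundary G \<phi> s #> x"
      have c: "?c \<in> carrier (filter_quotient G \<phi> s)" using x by (auto simp: carrier_filter_quotient)
      have "x \<in> ?c"
        using x filter_subset boundary_subgroup by (blast intro: rcos_self)
      also have "?c = boundary G \<phi> s #> \<tau> s ?c"
        using \<tau>[of s] c by (auto simp: transversal_def)
      finally obtain b' where b': "b' \<in> boundary G \<phi> s" "x = b' \<otimes> \<tau> s ?c"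
        by (auto simp: r_coset_def)
      have "\<tau> s ?c \<in> generate G ?X" using True c by (blast intro: generate.incl)
      with b b'(1) have "b' \<otimes> \<tau> s ?c \<in> generate G ?X" by (intro generate.eng) auto
      then show "x \<in> generate G ?X" by (simp only: b'(2)[symmetric])
    qed
  next
    case False
    then show ?thesis using b by (simp add: support_index_def)
  qed
  have "\<forall>B \<in> inertia_level G \<phi> i. B \<subseteq> generate G ?X" for i
  proof (induction i)
    case 0
    then show ?case by (simp add: generate.one)
  next
    case (Suc i)
    have "\<phi> s \<subseteq> generate G ?X"
      if "\<B> \<subseteq> inertia_level G \<phi> i" "boundary G \<phi> s = generate G (\<Union>\<B>)" for s \<B>
    proof (rule step)
      have "\<Union>\<B> \<subseteq> generate G ?X"
        using that(1) Suc.IH by (intro Union_least) (meson subsetD)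
      then show "boundary G \<phi> s \<subseteq> generate G ?X"
        unfolding that(2) by (rule generate_subgroup_incl[OF _ K])
    qed
    then show ?case by auto
  qed
  then have "\<phi> s \<subseteq> generate G ?X" for s
    using inertia unfolding inertia_free_def by blast
  then show ?thesis
    using filter_zero generate_incl[OF X] by blast
qed

end

section \<open>Isomorphisms of filtered groups\<close>

locale filtered_iso =
  G: filtered_group G prec \<phi> + H: filtered_group H prec \<theta>
  for G :: "('g, 'x) monoid_scheme" and H :: "('h, 'y) monoid_scheme"
    and prec :: "'m::comm_monoid_add \<Rightarrow> 'm \<Rightarrow> bool" and \<phi> \<theta> +
  fixes \<alpha> :: "'g \<Rightarrow> 'h"
  assumes iso: "\<alpha> \<in> iso G H" and image_filter: "\<alpha> ` \<phi> s = \<theta> s"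
begin

sublocale hom: group_hom G H \<alpha>
  using iso by unfold_locales (simp add: iso_def)

lemma inj: "inj_on \<alpha> (carrier G)"
  using iso by (simp add: iso_def bij_betw_def)

lemma image_carrier: "\<alpha> ` carrier G = carrier H"
  using iso by (simp add: iso_def bij_betw_def)

lemma image_boundary: "\<alpha> ` boundary G \<phi> s = boundary H \<theta> s"
proof -
  have "(\<Union>t\<in>-{0}. \<phi> (s + t)) \<subseteq> carrier G" using G.filter_subset by blast
  from hom.generate_img[OF this] show ?thesis
    by (simp add: boundary_def image_UN image_filter)
qed

lemma image_coset:
  assumes "x \<in> carrier G"
  shows "\<alpha> ` (boundary G \<phi> s #>\<^bsub>G\<^esub> x) = boundary H \<theta> s #>\<^bsub>H\<^esub> \<alpha> x"
  using coset_hom(2)[OF hom.homh G.boundary_subset assms] by (simp add: image_boundary)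

lemma image_filter_quotient_iso:
  "image \<alpha> \<in> iso (filter_quotient G \<phi> s) (filter_quotient H \<theta> s)"
proof (rule isoI)
  let ?Q = "filter_quotient G \<phi> s" and ?R = "filter_quotient H \<theta> s"
  have onto: "image \<alpha> ` carrier ?Q = carrier ?R"
  proof -
    have "image \<alpha> ` carrier ?Q = (\<lambda>x. boundary H \<theta> s #>\<^bsub>H\<^esub> \<alpha> x) ` \<phi> s"
      unfolding G.carrier_filter_quotient image_image
      using image_coset G.filter_subset by (intro image_cong refl) blast
    then show ?thesis
      by (simp add: H.carrier_filter_quotient image_image flip: image_filter)
  qed
  show "image \<alpha> \<in> hom ?Q ?R"
  proof (rule homI)
    show "\<alpha> ` A \<in> carrier ?R" if "A \<in> carrier ?Q" for A
      using that onto by blast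
    show "\<alpha> ` (A \<otimes>\<^bsub>?Q\<^esub> B) = (\<alpha> ` A) \<otimes>\<^bsub>?R\<^esub> (\<alpha> ` B)"
      if "A \<in> carrier ?Q" "B \<in> carrier ?Q" for A B
      unfolding G.mult_filter_quotient H.mult_filter_quotient
      using that[THEN G.filter_quotient_coset_subset] by (rule set_mult_hom[OF hom.homh])
  qed
  have "carrier ?Q \<subseteq> Pow (carrier G)" using G.filter_quotient_coset_subset by blast
  then have "inj_on (image \<alpha>) (carrier ?Q)"
    using inj_on_image_Pow[OF inj] inj_on_subset by blast
  then show "bij_betw (image \<alpha>) (carrier ?Q) (carrier ?R)"
    using onto by (simp add: bij_betw_def)
qed

lemma image_eq_boundary_iff:
  assumes "A \<in> carrier (filter_quotient G \<phi> s)"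
  shows "\<alpha> ` A = boundary H \<theta> s \<longleftrightarrow> A = boundary G \<phi> s"
  unfolding image_boundary[symmetric]
  using inj_on_image_eq_iff[OF inj] G.filter_quotient_coset_subset[OF assms] G.boundary_subset
  by blast

text \<open>By \<open>coset_bracket_eq\<close> the bracket of cosets is the coset of the commutator of
  representatives, and \<open>\<alpha>\<close> commutes with commutators.\<close>

lemma image_coset_bracket:
  assumes "A \<in> carrier (filter_quotient G \<phi> s)" "B \<in> carrier (filter_quotient G \<phi> t)"
  shows "\<alpha> ` coset_bracket G \<phi> s t A B = coset_bracket H \<theta> s t (\<alpha> ` A) (\<alpha> ` B)"
proof -
  obtain x y where x: "x \<in> \<phi> s" "A = boundary G \<phi> s #>\<^bsub>G\<^esub> x"
    and y: "y \<in> \<phi> t" "B = boundary G \<phi> t #>\<^bsub>G\<^esub> y"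
    using assms by (auto simp: G.carrier_filter_quotient)
  have c: "x \<in> carrier G" "y \<in> carrier G" using x y G.filter_subset by auto
  have m: "\<alpha> x \<in> \<theta> s" "\<alpha> y \<in> \<theta> t" using x y image_filter by blast+
  show ?thesis
    using c x(2) y(2)
      coset_bracket_eq[OF G.is_group G.conical G.filter x(1) y(1)]
      coset_bracket_eq[OF H.is_group H.conical H.filter m]
    by (simp add: image_coset hom.hom_commutator)
qed

definition graded_map :: "('m \<Rightarrow> 'g set) \<Rightarrow> ('m \<Rightarrow> 'h set)" where
  "graded_map f = (\<lambda>s\<in>-{0}. \<alpha> ` f s)"

lemma graded_map_iso: "graded_map \<in> iso (graded_lie_ring G \<phi>) (graded_lie_ring H \<theta>)"
proof -
  have "graded_map \<in> iso (sum_group (-{0}) (filter_quotient G \<phi>))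
      (sum_group (-{0}) (filter_quotient H \<theta>))"
    unfolding graded_map_def[abs_def]
    by (intro iso_sum_group_componentwise G.group_filter_quotient H.group_filter_quotient
        image_filter_quotient_iso)
  then show ?thesis
    by (simp add: graded_lie_ring_def monoid.extend_def lie_ring.fields_def iso_def hom_def)
qed

lemma graded_map_eq_boundary_iff:
  assumes "f \<in> carrier (graded_lie_ring G \<phi>)" and "s \<noteq> 0"
  shows "graded_map f s = boundary H \<theta> s \<longleftrightarrow> f s = boundary G \<phi> s"
  using assms by (simp add: G.carrier_graded_lie_ring PiE_iff graded_map_def image_eq_boundary_iff)

text \<open>Both brackets are products over pairs of degrees in which the two arguments are
  non-trivial. Since \<open>\<alpha>\<close> preserves triviality of cosets, the two index sets coincide, and the
  factors correspond.\<close>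

lemma graded_map_bracket:
  assumes f: "f \<in> carrier (graded_lie_ring G \<phi>)" and g: "g \<in> carrier (graded_lie_ring G \<phi>)"
  shows "graded_map (lie_bracket (graded_lie_ring G \<phi>) f g)
    = lie_bracket (graded_lie_ring H \<theta>) (graded_map f) (graded_map g)"
proof -
  have fq: "f s \<in> carrier (filter_quotient G \<phi> s)" and gq: "g s \<in> carrier (filter_quotient G \<phi> s)"
    if "s \<noteq> 0" for s
    using that f g by (auto simp: G.carrier_graded_lie_ring PiE_iff)
  define P where "P u = {(s, t). s \<noteq> 0 \<and> t \<noteq> 0 \<and> s + t = u \<and>
      f s \<noteq> boundary G \<phi> s \<and> g t \<noteq> boundary G \<phi> t}" for u
  have P': "P u = {(s, t). s \<noteq> 0 \<and> t \<noteq> 0 \<and> s + t = u \<and>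
      graded_map f s \<noteq> boundary H \<theta> s \<and> graded_map g t \<noteq> boundary H \<theta> t}" for u
    unfolding P_def
    by (simp add: graded_map_eq_boundary_iff[OF f] graded_map_eq_boundary_iff[OF g] cong: conj_cong)
  have "\<alpha> ` finprod (filter_quotient G \<phi> u) (\<lambda>(s, t). coset_bracket G \<phi> s t (f s) (g t)) (P u)
    = finprod (filter_quotient H \<theta> u)
        (\<lambda>(s, t). coset_bracket H \<theta> s t (graded_map f s) (graded_map g t)) (P u)"
    (is "_ ` finprod ?Q ?b _ = finprod ?R ?b' _") if u: "u \<noteq> 0" for u
  proof -
    interpret R: comm_group ?R using u by (rule H.comm_group_filter_quotient)
    have b: "?b \<in> P u \<rightarrow> carrier ?Q"
      using G.coset_bracket_closed fq gq by (auto simp: P_def)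
    have eq: "(image \<alpha> \<circ> ?b) p = ?b' p" if "p \<in> P u" for p
      using that by (clarsimp simp: P_def graded_map_def image_coset_bracket fq gq)
    have hom: "image \<alpha> \<in> hom ?Q ?R"
      using image_filter_quotient_iso by (rule iso_imp_homomorphism)
    have "\<alpha> ` finprod ?Q ?b (P u) = finprod ?R (image \<alpha> \<circ> ?b) (P u)"
      by (rule hom_finprod[OF G.comm_group_filter_quotient[OF u] R.comm_group_axioms hom b])
    also have "\<dots> = finprod ?R ?b' (P u)"
    proof (rule R.finprod_cong'[OF refl _ eq])
      show "?b' \<in> P u \<rightarrow> carrier ?R"
      proof
        fix p assume p: "p \<in> P u"
        have "(image \<alpha> \<circ> ?b) p \<in> carrier ?R"
          unfolding o_def using hom_in_carrier[OF hom] b p by blast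
        then show "?b' p \<in> carrier ?R" using eq[OF p] by simp
      qed
    qed
    finally show ?thesis .
  qed
  then show ?thesis
    by (simp add: graded_lie_ring_def monoid.extend_def lie_ring.fields_def
        G.one_filter_quotient H.one_filter_quotient P'[symmetric] P_def[symmetric]
        graded_map_def[of "restrict _ _"] cong: restrict_cong)
qed

lemma graded_map_homogeneous_component:
  assumes "s \<noteq> 0"
  shows "graded_map ` homogeneous_component G \<phi> s = homogeneous_component H \<theta> s"
proof -
  have iff: "graded_map f \<in> homogeneous_component H \<theta> s \<longleftrightarrow> f \<in> homogeneous_component G \<phi> s"
    if f: "f \<in> carrier (graded_lie_ring G \<phi>)" for f
  proof -
    have "graded_map f \<in> carrier (graded_lie_ring H \<theta>)"
      using f graded_map_iso by (auto simp: iso_def hom_def)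
    then show ?thesis
      using f graded_map_eq_boundary_iff[OF f] by (auto simp: homogeneous_component_def G.one_filter_quotient H.one_filter_quotient)
  qed
  have onto: "graded_map ` carrier (graded_lie_ring G \<phi>) = carrier (graded_lie_ring H \<theta>)"
    using graded_map_iso by (simp add: iso_def bij_betw_def)
  have sub: "homogeneous_component G \<phi> s \<subseteq> carrier (graded_lie_ring G \<phi>)"
    "homogeneous_component H \<theta> s \<subseteq> carrier (graded_lie_ring H \<theta>)"
    by (auto simp: homogeneous_component_def)
  show ?thesis
  proof (intro subset_antisym subsetI)
    show "h \<in> homogeneous_component H \<theta> s" if "h \<in> graded_map ` homogeneous_component G \<phi> s" for h
      using that iff sub(1) by blast
    show "h \<in> graded_map ` homogeneous_component G \<phi> s" if "h \<in> homogeneous_component H \<theta> s" for h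
    proof -
      have "h \<in> graded_map ` carrier (graded_lie_ring G \<phi>)"
        unfolding onto by (rule subsetD[OF sub(2) that])
      then obtain f where f: "f \<in> carrier (graded_lie_ring G \<phi>)" "h = graded_map f" by blast
      then have "f \<in> homogeneous_component G \<phi> s" using that iff[OF f(1)] by simp
      then show ?thesis using f(2) by (simp only: imageI)
    qed
  qed
qed

theorem graded_map_graded_lie_ring_iso: "graded_lie_ring_iso G \<phi> H \<theta> graded_map"
  unfolding graded_lie_ring_iso_def
  using graded_map_iso graded_map_bracket graded_map_homogeneous_component by blast

text \<open>Degree \<open>0\<close> is a separate case because the Lie ring does not see it; there the only coset is
  the whole group, so the conventional value still agrees with the image under \<open>\<alpha>\<close>.\<close>

lemma degree_map_graded_map:
  assumes "c \<in> carrier (filter_quotient G \<phi> s)"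
  shows "degree_map G \<phi> H \<theta> graded_map s c = \<alpha> ` c"
proof (cases "s = 0")
  case True
  then have "c = carrier G"
    using assms by (auto simp: G.carrier_filter_quotient G.boundary_zero G.filter_zero
        G.coset_join2[OF _ G.subgroup_self])
  then show ?thesis
    using True by (simp add: degree_map_def H.one_filter_quotient H.boundary_zero image_carrier)
next
  case False
  then show ?thesis
    by (simp add: degree_map_def graded_map_def homogeneous_element_def)
qed

text \<open>Transporting a transversal along \<open>\<alpha>\<close> makes the partial lift agree with \<open>\<alpha>\<close> on all
  representatives. As generating set of each quotient serves the whole quotient.\<close>

theorem is_lift_graded_map:
  assumes inertia: "inertia_free G \<phi>"
  shows "is_lift G \<phi> H \<theta> graded_map \<alpha>"
proof -
  let ?Q = "filter_quotient G \<phi>" and ?R = "filter_quotient H \<theta>"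
  define \<tau> where "\<tau> s c = (SOME x. x \<in> \<phi> s \<and> boundary G \<phi> s #>\<^bsub>G\<^esub> x = c)" for s c
  define \<sigma> where "\<sigma> s d = \<alpha> (\<tau> s (inv_into (carrier (?Q s)) (image \<alpha>) d))" for s d
  have \<tau>: "transversal G \<phi> s (\<tau> s)" for s
    unfolding transversal_def
  proof
    fix c assume "c \<in> carrier (?Q s)"
    then have "\<exists>x. x \<in> \<phi> s \<and> boundary G \<phi> s #>\<^bsub>G\<^esub> x = c"
      by (auto simp: G.carrier_filter_quotient)
    then show "\<tau> s c \<in> \<phi> s \<and> boundary G \<phi> s #>\<^bsub>G\<^esub> \<tau> s c = c"
      unfolding \<tau>_def by (rule someI_ex)
  qed
  have bij: "bij_betw (image \<alpha>) (carrier (?Q s)) (carrier (?R s))" for s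
    using image_filter_quotient_iso by (simp add: iso_def)
  have \<sigma>_image: "\<sigma> s (\<alpha> ` c) = \<alpha> (\<tau> s c)" if "c \<in> carrier (?Q s)" for s c
    using that bij[of s] by (simp add: \<sigma>_def bij_betw_def inv_into_f_f)
  have \<sigma>: "transversal H \<theta> s (\<sigma> s)" for s
    unfolding transversal_def
  proof
    fix d assume "d \<in> carrier (?R s)"
    then obtain c where c: "c \<in> carrier (?Q s)" "d = \<alpha> ` c"
      using bij_betw_imp_surj_on[OF bij, of s] by blast
    have t: "\<tau> s c \<in> \<phi> s" "boundary G \<phi> s #>\<^bsub>G\<^esub> \<tau> s c = c"
      using \<tau>[of s] c(1) by (auto simp: transversal_def)
    have "\<tau> s c \<in> carrier G" using t(1) G.filter_subset by blast
    from image_coset[OF this, of s] have "boundary H \<theta> s #>\<^bsub>H\<^esub> \<alpha> (\<tau> s c) = d"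
      unfolding t(2) c(2) by (rule sym)
    moreover have "\<alpha> (\<tau> s c) \<in> \<theta> s"
      using t(1) image_filter by blast
    ultimately show "\<sigma> s d \<in> \<theta> s \<and> boundary H \<theta> s #>\<^bsub>H\<^esub> \<sigma> s d = d"
      using \<sigma>_image c by simp
  qed
  have "\<alpha> x = partial_lift G \<phi> H \<theta> graded_map \<sigma> s x" if "x \<in> \<tau> s ` carrier (?Q s)" for s x
  proof -
    obtain c where c: "c \<in> carrier (?Q s)" "x = \<tau> s c" using \<open>x \<in> \<tau> s ` carrier (?Q s)\<close> by blast
    then have "boundary G \<phi> s #>\<^bsub>G\<^esub> x = c" using \<tau>[of s] by (auto simp: transversal_def)
    then show ?thesis
      using c by (simp add: partial_lift_def degree_map_graded_map \<sigma>_image)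
  qed
  moreover have "generate (?Q s) (carrier (?Q s)) = carrier (?Q s)" for s
    using group.generateI[OF G.group_filter_quotient group.subgroup_self[OF G.group_filter_quotient]]
    by auto
  ultimately show ?thesis
    unfolding is_lift_def
    using \<tau> \<sigma> G.generate_transversals[OF inertia \<tau>] hom.homh
    by (intro conjI exI[of _ \<tau>] exI[of _ \<sigma>] exI[of _ "\<lambda>s. carrier (?Q s)"]
        exI[of _ "\<lambda>s. \<tau> s ` carrier (?Q s)"]) auto
qed

end

section \<open>Filter functors\<close>

text \<open>Functoriality gives only an inclusion; applied to the inverse of \<open>\<alpha>\<close> it gives the
  reverse one.\<close>

lemma filter_functor_image_iso:
  assumes \<phi>: "filter_functor prec \<phi>" and G: "fg_nilpotent_group G" and H: "fg_nilpotent_group H"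
    and \<alpha>: "\<alpha> \<in> iso G H"
  shows "\<alpha> ` \<phi> G s = \<phi> H s"
proof
  have grp: "group G" "group H"
    using G H by (auto simp: fg_nilpotent_group_def nilpotent_group_def)
  let ?\<gamma> = "inv_into (carrier G) \<alpha>"
  have \<gamma>: "?\<gamma> \<in> iso H G" using group.iso_set_sym[OF grp(1) \<alpha>] .
  have image: "\<beta> ` \<phi> K s \<subseteq> \<phi> L s"
    if "fg_nilpotent_group K" "fg_nilpotent_group L" "\<beta> \<in> iso K L" for K L \<beta>
    using \<phi> that by (simp add: filter_functor_def iso_def)
  show "\<alpha> ` \<phi> G s \<subseteq> \<phi> H s" using image[OF G H \<alpha>] .
  have "\<phi> H s \<lhd> H" using \<phi> H by (simp add: filter_functor_def group_filter_def)
  then have sub: "\<phi> H s \<subseteq> carrier H" by (meson normal_imp_subgroup subgroup.subset)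
  show "\<phi> H s \<subseteq> \<alpha> ` \<phi> G s"
  proof
    fix y assume y: "y \<in> \<phi> H s"
    then have "y \<in> \<alpha> ` carrier G"
      using sub \<alpha> by (auto simp: iso_def bij_betw_def)
    then have "\<alpha> (?\<gamma> y) = y" by (rule f_inv_into_f)
    moreover have "?\<gamma> y \<in> \<phi> G s" using image[OF H G \<gamma>] y by blast
    ultimately show "y \<in> \<alpha> ` \<phi> G s" by (metis image_eqI)
  qed
qed

theorem theorem1:
  fixes prec :: "'m::comm_monoid_add \<Rightarrow> 'm \<Rightarrow> bool"
    and \<phi> :: "'g monoid \<Rightarrow> 'm \<Rightarrow> 'g set"
    and G H :: "'g monoid"
    and \<alpha> :: "'g \<Rightarrow> 'g"
  assumes "finitely_generated_monoid TYPE('m)"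
    and "conical_preorder prec"
    and "filter_functor prec \<phi>"
    and "\<And>K. fg_nilpotent_group K \<Longrightarrow>
           finite_filter (\<phi> K) \<and> inertia_free K (\<phi> K) \<and> faithful_filter K (\<phi> K)"
    and "fg_nilpotent_group G"
    and "fg_nilpotent_group H"
    and "\<alpha> \<in> iso G H"
  shows "\<exists>\<beta>. graded_lie_ring_iso G (\<phi> G) H (\<phi> H) \<beta> \<and> is_lift G (\<phi> G) H (\<phi> H) \<beta> \<alpha>"
proof -
  have filtered: "filtered_group K prec (\<phi> K)" if "fg_nilpotent_group K" for K
    using that assms(2,3)
    by (simp add: filtered_group_def filtered_group_axioms_def filter_functor_def
        fg_nilpotent_group_def nilpotent_group_def)
  interpret filtered_iso G H prec "\<phi> G" "\<phi> H" \<alpha>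
    using filtered[OF assms(5)] filtered[OF assms(6)] assms(7)
      filter_functor_image_iso[OF assms(3,5,6,7)]
    by (simp add: filtered_iso_def filtered_iso_axioms_def)
  show ?thesis
    using graded_map_graded_lie_ring_iso is_lift_graded_map assms(4)[OF assms(5)] by blast
qed

end
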